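(* Let $X$ be a homotopically stratified set, fix a basepoint $x_i\in X^i$ in each stratum, let $i\le j$ and write $H^{ij}=\mathrm{holink}(X^i\cup X^j,X^i)$. Consider the evaluation maps $E_0:H^{ij}\to X^i$, $\gamma\mapsto\gamma(0)$, and $E_1:H^{ij}\to X^j$, $\gamma\mapsto\gamma(1)$, and their fibres $E_0^{-1}(x_i),E_1^{-1}(x_j)\subset H^{ij}$. Then the following five maps are fibrations: $$E_0:H^{ij}\to X^i,\qquad E_1:H^{ij}\to X^j,\qquad E_0|:E_1^{-1}(x_j)\to X^i,\qquad E_1|:E_0^{-1}(x_i)\to X^j,$$ $$E_0\times E_1:H^{ij}\to X^i\times X^j.$$
   Context: All spaces are compactly generated; mapping spaces carry the $k$-ification of the compact-open topology. "Fibration" means a map with the homotopy lifting property for all spaces. Filtered space: a topological space $X$ with non-empty closed subspaces $X_i$ indexed by a poset $P_X$ such that $X_i\subset X_j\iff i\le j$, and such that the strata $X^i=X_i-\bigcup_{j<i}X_j$ partition $X$. Homotopy link: for $A\subset B$, $\mathrm{holink}(B,A)$ is the space of paths $\gamma:[0,1]\to B$ with $\gamma(0)\in A$ and $\gamma((0,1])\subset B-A$; $E_t$ denotes evaluation at $t$. For strata with $i<j$, $\mathrm{holink}(X^i\cup X^j,X^i)$ is thus the space of paths with $\gamma(0)\in X^i$ and $\gamma((0,1])\subset X^j$; for $i=j$ the same description is used, i.e. $H^{ii}$ is the space of all paths in $X^i$. A subspace $A$ of a filtered space $B$ is tame if there are a neighbourhood $N$ of $A$ and a deformation retraction of $N$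 onto $A$ under which each point remains in its own stratum for all times $t<1$. Homotopically stratified set: a filtered space $X$ with finitely many strata $X^i$, all connected, such that for any $i\le j$ (1) the inclusion $X^i\hookrightarrow X^i\cup X^j$ is tame, and (2) $E_0:\mathrm{holink}(X^i\cup X^j,X^i)\to X^i$ is a fibration. *)

theory Defs
  imports "HOL-Analysis.Analysis"
begin

section \<open>Compactly generated spaces\<close>

text \<open>
  Throughout, ``compactly generated'' is \<^const>\<open>k_space\<close>. In this category subspaces, products
  and mapping spaces carry the k-ification of the usual topology. No separation axiom is imposed.
\<close>

abbreviation unit_interval :: "real topology"
  where "unit_interval \<equiv> top_of_set {0..1}"

definition k_subspace :: "'a topology \<Rightarrow> 'a set \<Rightarrow> 'a topology"
  where "k_subspace X S = kification (subtopology X S)"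

definition k_prod :: "'a topology \<Rightarrow> 'b topology \<Rightarrow> ('a \<times> 'b) topology"
  where "k_prod X Y = kification (prod_topology X Y)"

text \<open>
  Points of a mapping space are the continuous maps, represented by functions that are
  \<^const>\<open>undefined\<close> outside the domain so that equality of points is equality of maps.
\<close>

definition mapping_set :: "'a topology \<Rightarrow> 'b topology \<Rightarrow> ('a \<Rightarrow> 'b) set"
  where "mapping_set X Y = {f \<in> extensional (topspace X). continuous_map X Y f}"

definition compact_open_topology :: "'a topology \<Rightarrow> 'b topology \<Rightarrow> ('a \<Rightarrow> 'b) topology"
  where "compact_open_topology X Y =
    topology_generated_by {{f \<in> mapping_set X Y. f ` K \<subseteq> U} |K U. compactin X K \<and> openin Y U}"

definition path_space :: "'a topology \<Rightarrow> (real \<Rightarrow> 'a) topology"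
  where "path_space X = kification (compact_open_topology unit_interval X)"

lemma topspace_compact_open_topology [simp]:
  "topspace (compact_open_topology X Y) = mapping_set X Y"
proof -
  have "mapping_set X Y \<in> {{f \<in> mapping_set X Y. f ` K \<subseteq> U} |K U. compactin X K \<and> openin Y U}"
    by (auto intro!: exI[of _ "{}"])
  then show ?thesis
    unfolding compact_open_topology_def topology_generated_by_topspace by auto
qed

lemma topspace_path_space [simp]: "topspace (path_space X) = mapping_set unit_interval X"
  by (simp add: path_space_def)


section \<open>Fibrations\<close>

text \<open>The products \<open>I \<times> Z\<close> need no k-ification, because \<open>I\<close> is locally compact.\<close>

definition has_hlp :: "'z topology \<Rightarrow> 'e topology \<Rightarrow> 'b topology \<Rightarrow> ('e \<Rightarrow> 'b) \<Rightarrow> bool"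
  where "has_hlp Z E B p \<longleftrightarrow>
    (\<forall>f h. continuous_map Z E f \<and> continuous_map (prod_topology unit_interval Z) B h \<and>
           (\<forall>z\<in>topspace Z. h (0, z) = p (f z)) \<longrightarrow>
       (\<exists>g. continuous_map (prod_topology unit_interval Z) E g \<and>
            (\<forall>z\<in>topspace Z. g (0, z) = f z) \<and>
            (\<forall>t\<in>{0..1}. \<forall>z\<in>topspace Z. p (g (t, z)) = h (t, z))))"

text \<open>
  A definition cannot quantify over types, so the test spaces below live on one type, chosen large
  enough to carry the universal test space \<open>{(e, w). p e = w 0}\<close>. Nothing is lost: the theorem
  \<open>fibration_has_hlp\<close> below gives the homotopy lifting property for the
  compactly generated spaces on every type.
\<close>

definition fibration :: "'e topology \<Rightarrow> 'b topology \<Rightarrow> ('e \<Rightarrow> 'b) \<Rightarrow> bool"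
  where "fibration E B p \<longleftrightarrow> continuous_map E B p \<and>
    (\<forall>Z :: ('e \<times> (real \<Rightarrow> 'b)) topology. k_space Z \<longrightarrow> has_hlp Z E B p)"

lemma continuous_map_curry:
  assumes h: "continuous_map (prod_topology unit_interval Z) B h"
  shows "continuous_map Z (compact_open_topology unit_interval B) (\<lambda>z. \<lambda>t\<in>{0..1}. h (t, z))"
proof -
  let ?c = "\<lambda>z. \<lambda>t\<in>{0..1::real}. h (t, z)"
  have maps: "?c z \<in> mapping_set unit_interval B" if "z \<in> topspace Z" for z
  proof -
    have "continuous_map unit_interval B (h \<circ> (\<lambda>t. (t, z)))"
      by (rule continuous_map_compose[OF _ h]) (simp add: continuous_map_pairwise o_def that)
    then have "continuous_map unit_interval B (?c z)"
      by (rule continuous_map_eq) auto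
    then show ?thesis by (simp add: mapping_set_def)
  qed
  have "openin Z (?c -` {f \<in> mapping_set unit_interval B. f ` K \<subseteq> U} \<inter> topspace Z)"
    if K: "compactin unit_interval K" and U: "openin B U" for K U
  proof (subst openin_subopen, intro ballI)
    fix z assume z: "z \<in> ?c -` {f \<in> mapping_set unit_interval B. f ` K \<subseteq> U} \<inter> topspace Z"
    let ?W = "{x \<in> topspace (prod_topology unit_interval Z). h x \<in> U}"
    have K01: "K \<subseteq> {0..1}"
      using K compactin_subset_topspace by fastforce
    have "openin (prod_topology unit_interval Z) ?W"
      by (rule openin_continuous_map_preimage[OF h U])
    moreover have "K \<times> {z} \<subseteq> ?W"
      using z K01 by force
    moreover have "z \<in> topspace Z" using z by blast
    ultimately obtain T V where "K \<subseteq> T" and V: "openin Z V" "z \<in> V" and "T \<times> V \<subseteq> ?W"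
      using tube_lemma_left[OF _ K, of Z ?W z] by blast
    then have KV: "K \<times> V \<subseteq> ?W" by blast
    have "V \<subseteq> ?c -` {f \<in> mapping_set unit_interval B. f ` K \<subseteq> U} \<inter> topspace Z"
    proof
      fix v assume v: "v \<in> V"
      then have vZ: "v \<in> topspace Z" using openin_subset[OF V(1)] by blast
      have "h (t, v) \<in> U" if "t \<in> K" for t using KV v that by blast
      then have "?c v ` K \<subseteq> U" using K01 by (auto simp: subset_iff)
      then show "v \<in> ?c -` {f \<in> mapping_set unit_interval B. f ` K \<subseteq> U} \<inter> topspace Z"
        using maps[OF vZ] vZ by simp
    qed
    with V show "\<exists>T. openin Z T \<and> z \<in> T \<and>
        T \<subseteq> ?c -` {f \<in> mapping_set unit_interval B. f ` K \<subseteq> U} \<inter> topspace Z"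
      by blast
  qed
  moreover have "?c ` topspace Z \<subseteq> topspace (compact_open_topology unit_interval B)"
    using maps by auto
  ultimately show ?thesis
    unfolding compact_open_topology_def continuous_on_generated_topo_iff
      topology_generated_by_topspace by blast
qed

lemma continuous_map_eval:
  "continuous_map (prod_topology unit_interval (compact_open_topology unit_interval B)) B
     (\<lambda>(t, w). w t)"
  (is "continuous_map ?P B ?e")
proof -
  have "openin ?P {x \<in> topspace ?P. ?e x \<in> U}" if U: "openin B U" for U
  proof (subst openin_subopen, intro ballI)
    fix x assume "x \<in> {x \<in> topspace ?P. ?e x \<in> U}"
    then obtain t w where x: "x = (t, w)" and t: "t \<in> {0..1}" and w: "w \<in> mapping_set unit_interval B"
      and wt: "w t \<in> U" by auto
    have "openin unit_interval {s \<in> topspace unit_interval. w s \<in> U}"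
      using w U openin_continuous_map_preimage unfolding mapping_set_def by blast
    moreover have "t \<in> {s \<in> topspace unit_interval. w s \<in> U}" using t wt by simp
    ultimately obtain e where e: "e > 0" "ball t e \<inter> {0..1} \<subseteq> {s \<in> topspace unit_interval. w s \<in> U}"
      unfolding openin_contains_ball by meson
    define K where "K = cball t (e/2) \<inter> {0..1}"
    have "cball t (e/2) \<subseteq> ball t e" using e by auto
    then have wK: "w ` K \<subseteq> U" using e unfolding K_def by blast
    have "compact K" unfolding K_def by (intro compact_Int compact_cball compact_Icc)
    then have K: "compactin unit_interval K"
      by (simp add: compactin_subtopology K_def)
    define V where "V = {f \<in> mapping_set unit_interval B. f ` K \<subseteq> U}"
    have "openin (compact_open_topology unit_interval B) V"
      unfolding compact_open_topology_def V_def
      by (rule topology_generated_by_Basis) (use K U in blast)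
    moreover have "openin unit_interval ({0..1} \<inter> ball t (e/2))"
      by (simp add: openin_open_Int)
    ultimately have "openin ?P (({0..1} \<inter> ball t (e/2)) \<times> V)"
      by (simp add: openin_prod_Times_iff)
    moreover have "x \<in> ({0..1} \<inter> ball t (e/2)) \<times> V"
      using x t w wK e by (simp add: V_def)
    moreover have "({0..1} \<inter> ball t (e/2)) \<times> V \<subseteq> {x \<in> topspace ?P. ?e x \<in> U}"
      by (auto simp: V_def K_def)
    ultimately show "\<exists>T. openin ?P T \<and> x \<in> T \<and> T \<subseteq> {x \<in> topspace ?P. ?e x \<in> U}"
      by blast
  qed
  moreover have "?e \<in> topspace ?P \<rightarrow> topspace B"
    by (auto simp: mapping_set_def continuous_map_def)
  ultimately show ?thesis
    unfolding continuous_map_def by blast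
qed

theorem fibration_has_hlp:
  fixes Z :: "'z topology"
  assumes fib: "fibration E B p" and Z: "k_space Z"
  shows "has_hlp Z E B p"
  unfolding has_hlp_def
proof (intro allI impI, elim conjE)
  fix f h
  assume f: "continuous_map Z E f" and h: "continuous_map (prod_topology unit_interval Z) B h"
    and h0: "\<forall>z\<in>topspace Z. h (0, z) = p (f z)"
  let ?C = "compact_open_topology unit_interval B"
  define N where "N = kification (subtopology (prod_topology E ?C) {(e, w). p e = w 0})"
  define q where "q = (\<lambda>z. (f z, \<lambda>t\<in>{0..1}. h (t, z)))"
  have topN: "topspace N = topspace E \<times> mapping_set unit_interval B \<inter> {(e, w). p e = w 0}"
    by (simp add: N_def)
  have pr: "continuous_map N (prod_topology E ?C) id"
    unfolding N_def
    by (rule continuous_map_from_kification[OF continuous_map_from_subtopology[OF continuous_map_id]])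
  then have fstN: "continuous_map N E fst" and sndN: "continuous_map N ?C snd"
    unfolding continuous_map_pairwise by (simp_all add: o_def)
  have "continuous_map (prod_topology unit_interval N) (prod_topology unit_interval ?C)
      (\<lambda>x. (fst x, snd (snd x)))"
    by (rule continuous_map_pairedI[OF continuous_map_fst
        continuous_map_compose[OF continuous_map_snd sndN, unfolded o_def]])
  from continuous_map_compose[OF this continuous_map_eval]
  have ev: "continuous_map (prod_topology unit_interval N) B (\<lambda>x. snd (snd x) (fst x))"
    by (simp add: o_def)
  have "k_space N" unfolding N_def by (rule k_space_kification)
  then have lift: "has_hlp N E B p"
    using fib unfolding fibration_def by blast
  have start: "\<forall>y\<in>topspace N. snd (snd (0::real, y)) (fst (0::real, y)) = p (fst y)"
    unfolding topN by auto
  obtain g where g: "continuous_map (prod_topology unit_interval N) E g"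
    and g0: "\<forall>y\<in>topspace N. g (0, y) = fst y"
    and pg: "\<forall>t\<in>{0..1}. \<forall>y\<in>topspace N. p (g (t, y)) = snd y t"
  proof -
    have "\<exists>g. continuous_map (prod_topology unit_interval N) E g \<and>
        (\<forall>y\<in>topspace N. g (0, y) = fst y) \<and>
        (\<forall>t\<in>{0..1}. \<forall>y\<in>topspace N. p (g (t, y)) = snd (snd (t, y)) (fst (t, y)))"
      by (rule lift[unfolded has_hlp_def, rule_format, OF conjI[OF fstN conjI[OF ev start]]])
    then show ?thesis
      unfolding fst_conv snd_conv using that by blast
  qed
  have "continuous_map Z (prod_topology E ?C) q"
    unfolding q_def by (rule continuous_map_pairedI[OF f continuous_map_curry[OF h]])
  moreover have "q ` topspace Z \<subseteq> {(e, w). p e = w 0}"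
    using h0 by (auto simp: q_def)
  ultimately have q: "continuous_map Z N q"
    unfolding N_def continuous_map_into_kification[OF Z]
    by (simp add: continuous_map_in_subtopology image_subset_iff_funcset)
  then have qN: "q z \<in> topspace N" if "z \<in> topspace Z" for z
    using that by (auto simp: continuous_map_def)
  have "continuous_map (prod_topology unit_interval Z) (prod_topology unit_interval N)
      (\<lambda>x. (fst x, q (snd x)))"
    by (rule continuous_map_pairedI[OF continuous_map_fst
        continuous_map_compose[OF continuous_map_snd q, unfolded o_def]])
  from continuous_map_compose[OF this g]
  have "continuous_map (prod_topology unit_interval Z) E (\<lambda>x. g (fst x, q (snd x)))"
    by (simp add: o_def)
  moreover have "\<forall>z\<in>topspace Z. g (0, q z) = f z"
    using g0 qN by (simp add: q_def)
  moreover have "\<forall>t\<in>{0..1}. \<forall>z\<in>topspace Z. p (g (t, q z)) = h (t, z)"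
    using pg qN by (simp add: q_def)
  ultimately show "\<exists>g. continuous_map (prod_topology unit_interval Z) E g \<and>
            (\<forall>z\<in>topspace Z. g (0, z) = f z) \<and>
            (\<forall>t\<in>{0..1}. \<forall>z\<in>topspace Z. p (g (t, z)) = h (t, z))"
    by (intro exI[of _ "\<lambda>x. g (fst x, q (snd x))"]) simp
qed


section \<open>Homotopically stratified sets\<close>

definition stratum :: "('p::order \<Rightarrow> 'a set) \<Rightarrow> 'p \<Rightarrow> 'a set"
  where "stratum F i = F i - (\<Union>j\<in>{..<i}. F j)"

text \<open>The indexing poset is the whole type \<open>'p\<close>; \<open>F i\<close> is the closed subspace with index \<open>i\<close>.\<close>

definition filtered_space :: "'a topology \<Rightarrow> ('p::order \<Rightarrow> 'a set) \<Rightarrow> bool"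
  where "filtered_space X F \<longleftrightarrow>
    k_space X \<and>
    (\<forall>i. F i \<noteq> {} \<and> closedin X (F i)) \<and>
    (\<forall>i j. F i \<subseteq> F j \<longleftrightarrow> i \<le> j) \<and>
    disjoint_family (stratum F) \<and> (\<Union>i. stratum F i) = topspace X"

text \<open>
  \<open>tame B \<S> A\<close>: here \<open>\<S>\<close> is the set of strata of \<open>B\<close>. As in
  the lemma \<open>deformation_retract_of_space\<close>, the points of \<open>A\<close> are required to be fixed at time 1 only,
  the weaker of the two common conventions for deformation retractions.
\<close>

definition tame :: "'a topology \<Rightarrow> 'a set set \<Rightarrow> 'a set \<Rightarrow> bool"
  where "tame B \<S> A \<longleftrightarrow>
    (\<exists>N U h. openin B U \<and> A \<subseteq> U \<and> U \<subseteq> N \<and> N \<subseteq> topspace B \<and>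
       continuous_map (prod_topology unit_interval (k_subspace B N)) (k_subspace B N) h \<and>
       (\<forall>y\<in>N. h (0, y) = y) \<and>
       (\<forall>y\<in>N. h (1, y) \<in> A) \<and>
       (\<forall>a\<in>A. h (1, a) = a) \<and>
       (\<forall>S\<in>\<S>. \<forall>y\<in>N \<inter> S. \<forall>t\<in>{0..<1}. h (t, y) \<in> S))"

definition holink :: "'a topology \<Rightarrow> 'a set \<Rightarrow> (real \<Rightarrow> 'a) topology"
  where "holink B A = k_subspace (path_space B)
    {\<gamma>. \<gamma> 0 \<in> A \<and> (\<forall>t\<in>{0<..1}. \<gamma> t \<in> topspace B - A)}"

text \<open>
  For \<open>i = j\<close> the literal \<open>holink (X\<^sup>i, X\<^sup>i)\<close> would be empty; by convention it is the space of all
  paths in the stratum.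
\<close>

definition strata_holink :: "'a topology \<Rightarrow> ('p::order \<Rightarrow> 'a set) \<Rightarrow> 'p \<Rightarrow> 'p \<Rightarrow> (real \<Rightarrow> 'a) topology"
  where "strata_holink X F i j =
    (if i = j then path_space (k_subspace X (stratum F i))
     else holink (k_subspace X (stratum F i \<union> stratum F j)) (stratum F i))"

definition homotopically_stratified :: "'a topology \<Rightarrow> ('p::order \<Rightarrow> 'a set) \<Rightarrow> bool"
  where "homotopically_stratified X F \<longleftrightarrow>
    filtered_space X F \<and>
    finite (range (stratum F)) \<and>
    (\<forall>i. connected_space (k_subspace X (stratum F i))) \<and>
    (\<forall>i j. i \<le> j \<longrightarrow>
       tame (k_subspace X (stratum F i \<union> stratum F j)) {stratum F i, stratum F j} (stratum F i) \<and>
       fibration (strata_holink X F i j) (k_subspace X (stratum F i)) (\<lambda>\<gamma>. \<gamma> 0))"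

end

theory Submission
  imports Defs
begin

text \<open>
  Everything follows from the fibration property of \<open>E\<^sub>0 \<times> E\<^sub>1\<close>, and that follows from the one of
  \<open>E\<^sub>0\<close>. Given a homotopy \<open>(a, b)\<close> in \<open>X\<^sup>i \<times> X\<^sup>j\<close> starting at the end points of the paths \<open>f z\<close>, first
  lift \<open>a\<close> to a homotopy \<open>g\<close> of paths. The path \<open>g (s, z)\<close> starts at the desired point \<open>a (s, z)\<close>, but
  ends at an uncontrolled point of \<open>X\<^sup>j\<close>. As \<open>g (0, z) = f z\<close> ends at \<open>b (0, z)\<close>, this end point
  can be joined to \<open>b (s, z)\<close> inside \<open>X\<^sup>j\<close>: run back along the end points \<open>g (r, z) 1\<close> from \<open>r = s\<close> to
  \<open>r = 0\<close>, and then along \<open>b (r, z)\<close> from \<open>r = 0\<close> to \<open>r = s\<close>. Attaching this tail to \<open>g (s, z)\<close> changes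
  no starting point and does not leave \<open>X\<^sup>j\<close> after time 0, so the result is again a point of the link.
  Giving the tail the length \<open>2 * s\<close> makes it disappear at \<open>s = 0\<close>, so that the new homotopy still starts
  at \<open>f\<close> (lemma \<open>fibration_endpoints\<close>).

  The remaining claims hold for every map \<open>(p, q)\<close> that is a fibration over a product: lift homotopies
  of \<open>p\<close> while keeping \<open>q\<close> constant. This makes \<open>p\<close> a fibration, also when restricted to a fibre
  of \<open>q\<close> (lemmas \<open>fibration_component\<close> and \<open>fibration_component_on_fibre\<close>).

  Continuity into the k-ified subspaces, products and path spaces reduces to continuity into the
  plain ones, because each domain that occurs is compactly generated.
\<close>

section \<open>Maps into compactly generated subspaces, products and path spaces\<close>

lemma k_space_cylinder:
  assumes "k_space Z"
  shows "k_space (prod_topology unit_interval Z)"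
proof (rule k_space_prod_topology_left[OF _ _ assms])
  show "locally_compact_space unit_interval"
    by (rule compact_imp_locally_compact_space) (simp add: compact_space_subtopology)
  show "Hausdorff_space unit_interval \<or> regular_space unit_interval"
    by (simp add: Hausdorff_space_subtopology)
qed

lemma k_space_k_subspace [simp]: "k_space (k_subspace X S)"
  by (simp add: k_subspace_def)

lemma topspace_k_subspace [simp]: "topspace (k_subspace X S) = topspace X \<inter> S"
  by (simp add: k_subspace_def)

lemma k_subspace_topspace:
  assumes "k_space X" "topspace X \<subseteq> S"
  shows "k_subspace X S = X"
  using assms by (simp add: k_subspace_def subtopology_superset kification_eq_self)

lemma continuous_map_into_k_subspace:
  assumes "k_space Z"
  shows "continuous_map Z (k_subspace X S) f \<longleftrightarrow> continuous_map Z X f \<and> f \<in> topspace Z \<rightarrow> S"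
  unfolding k_subspace_def continuous_map_into_kification[OF assms]
  by (rule continuous_map_in_subtopology)

lemma continuous_map_from_k_subspace:
  assumes "continuous_map X Y f"
  shows "continuous_map (k_subspace X S) Y f"
  unfolding k_subspace_def
  by (rule continuous_map_from_kification[OF continuous_map_from_subtopology[OF assms]])

lemma continuous_map_k_subspace_inclusion:
  assumes "continuous_map Z (k_subspace X S) f"
  shows "continuous_map Z X f"
  using continuous_map_compose[OF assms continuous_map_from_k_subspace[OF continuous_map_id]]
  by simp

lemma continuous_map_into_k_prod:
  assumes "k_space Z"
  shows "continuous_map Z (k_prod X Y) f \<longleftrightarrow>
    continuous_map Z X (\<lambda>z. fst (f z)) \<and> continuous_map Z Y (\<lambda>z. snd (f z))"
  unfolding k_prod_def continuous_map_into_kification[OF assms]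
  by (simp add: continuous_map_pairwise o_def)

lemma continuous_map_k_prod_components:
  "continuous_map Z (k_prod X Y) f \<Longrightarrow>
    continuous_map Z X (\<lambda>z. fst (f z)) \<and> continuous_map Z Y (\<lambda>z. snd (f z))"
  using continuous_map_compose[OF _ continuous_map_from_kification[OF continuous_map_id], of Z "prod_topology X Y" f]
  by (simp add: k_prod_def continuous_map_pairwise o_def)

lemma continuous_map_path_eval:
  assumes "continuous_map Z (path_space B) f" and "continuous_map Z unit_interval \<tau>"
  shows "continuous_map Z B (\<lambda>z. f z (\<tau> z))"
proof -
  have "continuous_map Z (compact_open_topology unit_interval B) f"
    using continuous_map_compose[OF assms(1)[unfolded path_space_def]
        continuous_map_from_kification[OF continuous_map_id]] by simp
  then have "continuous_map Z (prod_topology unit_interval (compact_open_topology unit_interval B))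
      (\<lambda>z. (\<tau> z, f z))"
    by (rule continuous_map_pairedI[OF assms(2)])
  from continuous_map_compose[OF this continuous_map_eval]
  show ?thesis by (simp add: o_def)
qed

lemma continuous_map_into_path_space:
  assumes "k_space Z" and "continuous_map (prod_topology unit_interval Z) B h"
  shows "continuous_map Z (path_space B) (\<lambda>z. \<lambda>t\<in>{0..1}. h (t, z))"
  unfolding path_space_def continuous_map_into_kification[OF assms(1)]
  by (rule continuous_map_curry[OF assms(2)])


section \<open>Fibrations over a product\<close>

lemma fibrationI:
  fixes E :: "'e topology" and B :: "'b topology"
  assumes "continuous_map E B p"
    and "\<And>(Z :: ('e \<times> (real \<Rightarrow> 'b)) topology) f h.
      \<lbrakk>k_space Z; continuous_map Z E f; continuous_map (prod_topology unit_interval Z) B h;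
       \<And>z. z \<in> topspace Z \<Longrightarrow> h (0, z) = p (f z)\<rbrakk>
      \<Longrightarrow> \<exists>g. continuous_map (prod_topology unit_interval Z) E g \<and>
            (\<forall>z\<in>topspace Z. g (0, z) = f z) \<and>
            (\<forall>t\<in>{0..1}. \<forall>z\<in>topspace Z. p (g (t, z)) = h (t, z))"
  shows "fibration E B p"
  unfolding fibration_def has_hlp_def
  by (intro conjI allI impI assms(1), elim conjE, rule assms(2)) auto

lemma fibration_lift:
  assumes "fibration E B p" "k_space Z" "continuous_map Z E f"
    and "continuous_map (prod_topology unit_interval Z) B h"
    and "\<And>z. z \<in> topspace Z \<Longrightarrow> h (0, z) = p (f z)"
  obtains g where "continuous_map (prod_topology unit_interval Z) E g"
    and "\<And>z. z \<in> topspace Z \<Longrightarrow> g (0, z) = f z"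
    and "\<And>t z. \<lbrakk>t \<in> {0..1}; z \<in> topspace Z\<rbrakk> \<Longrightarrow> p (g (t, z)) = h (t, z)"
  using fibration_has_hlp[OF assms(1,2)] assms(3-5) unfolding has_hlp_def by metis

lemma fibration_swap:
  assumes fib: "fibration E (k_prod A C) (\<lambda>e. (p e, q e))" and E: "k_space E"
  shows "fibration E (k_prod C A) (\<lambda>e. (q e, p e))"
proof (rule fibrationI)
  show "continuous_map E (k_prod C A) (\<lambda>e. (q e, p e))"
    using fib unfolding fibration_def by (simp add: continuous_map_into_k_prod E)
next
  fix Z :: "('a \<times> (real \<Rightarrow> 'c \<times> 'b)) topology" and f h
  assume Z: "k_space Z" and f: "continuous_map Z E f"
    and h: "continuous_map (prod_topology unit_interval Z) (k_prod C A) h"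
    and h0: "\<And>z. z \<in> topspace Z \<Longrightarrow> h (0, z) = (q (f z), p (f z))"
  have "continuous_map (prod_topology unit_interval Z) (k_prod A C) (\<lambda>y. (snd (h y), fst (h y)))"
    using continuous_map_k_prod_components[OF h]
    by (simp add: continuous_map_into_k_prod k_space_cylinder Z)
  from fibration_lift[OF fib Z f this] h0
  obtain g where "continuous_map (prod_topology unit_interval Z) E g"
    and "\<And>z. z \<in> topspace Z \<Longrightarrow> g (0, z) = f z"
    and "\<And>t z. \<lbrakk>t \<in> {0..1}; z \<in> topspace Z\<rbrakk> \<Longrightarrow> (p (g (t, z)), q (g (t, z))) = (snd (h (t, z)), fst (h (t, z)))"
    by auto
  then show "\<exists>g. continuous_map (prod_topology unit_interval Z) E g \<and>
      (\<forall>z\<in>topspace Z. g (0, z) = f z) \<and>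
      (\<forall>t\<in>{0..1}. \<forall>z\<in>topspace Z. (q (g (t, z)), p (g (t, z))) = h (t, z))"
    by (intro exI[of _ g]) (simp add: prod_eq_iff)
qed

text \<open>
  Lifting the pair of a homotopy of \<open>p\<close> and the constant homotopy of \<open>q\<close> keeps every point in its
  fibre of \<open>q\<close>. The last conclusion is what the restriction to a fibre needs.
\<close>

lemma fibration_lift_component:
  assumes fib: "fibration E (k_prod A C) (\<lambda>e. (p e, q e))"
    and E: "k_space E" and Z: "k_space Z" and f: "continuous_map Z E f"
    and h: "continuous_map (prod_topology unit_interval Z) A h"
    and h0: "\<And>z. z \<in> topspace Z \<Longrightarrow> h (0, z) = p (f z)"
  obtains g where "continuous_map (prod_topology unit_interval Z) E g"
    and "\<And>z. z \<in> topspace Z \<Longrightarrow> g (0, z) = f z"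
    and "\<And>t z. \<lbrakk>t \<in> {0..1}; z \<in> topspace Z\<rbrakk> \<Longrightarrow> p (g (t, z)) = h (t, z)"
    and "\<And>t z. \<lbrakk>t \<in> {0..1}; z \<in> topspace Z\<rbrakk> \<Longrightarrow> q (g (t, z)) = q (f z)"
proof -
  have "continuous_map E C q"
    using fib unfolding fibration_def by (simp add: continuous_map_into_k_prod E)
  from continuous_map_compose[OF continuous_map_compose[OF continuous_map_snd f] this]
  have "continuous_map (prod_topology unit_interval Z) C (\<lambda>y. q (f (snd y)))"
    by (simp add: o_def)
  with h have "continuous_map (prod_topology unit_interval Z) (k_prod A C) (\<lambda>y. (h y, q (f (snd y))))"
    by (simp add: continuous_map_into_k_prod k_space_cylinder Z)
  from fibration_lift[OF fib Z f this] h0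
  obtain g where "continuous_map (prod_topology unit_interval Z) E g"
    and "\<And>z. z \<in> topspace Z \<Longrightarrow> g (0, z) = f z"
    and "\<And>t z. \<lbrakk>t \<in> {0..1}; z \<in> topspace Z\<rbrakk> \<Longrightarrow> (p (g (t, z)), q (g (t, z))) = (h (t, z), q (f z))"
    by auto
  then show thesis by (intro that[of g]) auto
qed

lemma fibration_component:
  assumes fib: "fibration E (k_prod A C) (\<lambda>e. (p e, q e))" and E: "k_space E"
  shows "fibration E A p"
proof (rule fibrationI)
  show "continuous_map E A p"
    using fib unfolding fibration_def by (simp add: continuous_map_into_k_prod E)
next
  fix Z :: "('a \<times> (real \<Rightarrow> 'b)) topology" and f h
  assume "k_space Z" and "continuous_map Z E f"
    and "continuous_map (prod_topology unit_interval Z) A h"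
    and "\<And>z. z \<in> topspace Z \<Longrightarrow> h (0, z) = p (f z)"
  from fibration_lift_component[OF fib E this]
  show "\<exists>g. continuous_map (prod_topology unit_interval Z) E g \<and>
      (\<forall>z\<in>topspace Z. g (0, z) = f z) \<and>
      (\<forall>t\<in>{0..1}. \<forall>z\<in>topspace Z. p (g (t, z)) = h (t, z))"
    by metis
qed

lemma fibration_component_on_fibre:
  assumes fib: "fibration E (k_prod A C) (\<lambda>e. (p e, q e))" and E: "k_space E"
  shows "fibration (k_subspace E {e \<in> topspace E. q e = c}) A p"
proof (rule fibrationI)
  show "continuous_map (k_subspace E {e \<in> topspace E. q e = c}) A p"
    using fibration_component[OF fib E] unfolding fibration_def
    by (blast intro: continuous_map_from_k_subspace)
next
  fix Z :: "('a \<times> (real \<Rightarrow> 'b)) topology" and f h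
  assume Z: "k_space Z"
    and f: "continuous_map Z (k_subspace E {e \<in> topspace E. q e = c}) f"
    and h: "continuous_map (prod_topology unit_interval Z) A h"
    and h0: "\<And>z. z \<in> topspace Z \<Longrightarrow> h (0, z) = p (f z)"
  have fE: "continuous_map Z E f" and fq: "\<And>z. z \<in> topspace Z \<Longrightarrow> q (f z) = c"
    using f by (auto simp: continuous_map_into_k_subspace Z)
  from fibration_lift_component[OF fib E Z fE h h0]
  obtain g where g: "continuous_map (prod_topology unit_interval Z) E g"
    and g0: "\<And>z. z \<in> topspace Z \<Longrightarrow> g (0, z) = f z"
    and pg: "\<And>t z. \<lbrakk>t \<in> {0..1}; z \<in> topspace Z\<rbrakk> \<Longrightarrow> p (g (t, z)) = h (t, z)"
    and qg: "\<And>t z. \<lbrakk>t \<in> {0..1}; z \<in> topspace Z\<rbrakk> \<Longrightarrow> q (g (t, z)) = q (f z)"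
    by blast
  have "g \<in> topspace (prod_topology unit_interval Z) \<rightarrow> {e \<in> topspace E. q e = c}"
    using continuous_map_funspace[OF g] qg fq by fastforce
  with g have "continuous_map (prod_topology unit_interval Z) (k_subspace E {e \<in> topspace E. q e = c}) g"
    by (simp add: continuous_map_into_k_subspace k_space_cylinder Z)
  with g0 pg show "\<exists>g. continuous_map (prod_topology unit_interval Z) (k_subspace E {e \<in> topspace E. q e = c}) g \<and>
      (\<forall>z\<in>topspace Z. g (0, z) = f z) \<and>
      (\<forall>t\<in>{0..1}. \<forall>z\<in>topspace Z. p (g (t, z)) = h (t, z))"
    by blast
qed


section \<open>Evaluation at both end points\<close>

text \<open>
  The space of paths that start in \<open>A\<close> and run in \<open>C\<close> afterwards. The sets \<open>A\<close> and \<open>C\<close> may coincide, so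
  that the homotopy link of two different strata and the path space of one stratum are both instances.
\<close>

definition paths_from_into :: "'a topology \<Rightarrow> 'a set \<Rightarrow> 'a set \<Rightarrow> (real \<Rightarrow> 'a) topology"
  where "paths_from_into X A C =
    k_subspace (path_space (k_subspace X (A \<union> C))) {\<gamma>. \<gamma> 0 \<in> A \<and> (\<forall>t\<in>{0<..1}. \<gamma> t \<in> C)}"

lemma k_space_paths_from_into: "k_space (paths_from_into X A C)"
  by (simp add: paths_from_into_def)

lemma paths_from_into_D:
  assumes "\<gamma> \<in> topspace (paths_from_into X A C)"
  shows "\<gamma> 0 \<in> A" and "\<And>t. 0 < t \<Longrightarrow> t \<le> 1 \<Longrightarrow> \<gamma> t \<in> C" and "\<gamma> \<in> extensional {0..1}"
  using assms by (auto simp: paths_from_into_def mapping_set_def)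

lemma continuous_map_paths_from_into_eval:
  assumes "continuous_map Z (paths_from_into X A C) f" and "continuous_map Z unit_interval \<tau>"
  shows "continuous_map Z X (\<lambda>z. f z (\<tau> z))"
proof -
  have "continuous_map Z (path_space (k_subspace X (A \<union> C))) f"
    using assms(1) unfolding paths_from_into_def by (rule continuous_map_k_subspace_inclusion)
  from continuous_map_k_subspace_inclusion[OF continuous_map_path_eval[OF this assms(2)]]
  show ?thesis .
qed

lemma continuous_map_into_paths_from_into:
  assumes Z: "k_space Z" and h: "continuous_map (prod_topology unit_interval Z) X h"
    and A: "\<And>z. z \<in> topspace Z \<Longrightarrow> h (0, z) \<in> A"
    and C: "\<And>t z. \<lbrakk>0 < t; t \<le> 1; z \<in> topspace Z\<rbrakk> \<Longrightarrow> h (t, z) \<in> C"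
  shows "continuous_map Z (paths_from_into X A C) (\<lambda>z. \<lambda>t\<in>{0..1}. h (t, z))"
proof -
  have "h (t, z) \<in> A \<union> C" if "0 \<le> t" "t \<le> 1" "z \<in> topspace Z" for t z
    using A[OF that(3)] C[OF _ that(2,3)] that(1) by (cases "t = 0") auto
  with h have "continuous_map (prod_topology unit_interval Z) (k_subspace X (A \<union> C)) h"
    by (simp add: continuous_map_into_k_subspace k_space_cylinder Z Pi_iff)
  from continuous_map_into_path_space[OF Z this] A C show ?thesis
    unfolding paths_from_into_def by (auto simp: continuous_map_into_k_subspace Z)
qed

lemma continuous_map_clamp:
  assumes "continuous_map Z euclideanreal f"
  shows "continuous_map Z unit_interval (\<lambda>z. max 0 (min 1 (f z)))"
  unfolding continuous_map_in_subtopology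
  using assms by (auto intro!: continuous_map_real_max continuous_map_real_min)

text \<open>
  Evaluation at 0 being a fibration, so is evaluation at both ends: a lift \<open>g\<close> of the homotopy of
  starting points is corrected by a tail in \<open>C\<close> that leads from the end point of \<open>g (s, z)\<close> back to
  the one of \<open>g (0, z)\<close> and from there along the given homotopy of end points.
\<close>

lemma fibration_endpoints:
  fixes X :: "'a topology" and A C :: "'a set"
  defines "H \<equiv> paths_from_into X A C"
  assumes fib: "fibration H (k_subspace X A) (\<lambda>\<gamma>. \<gamma> 0)"
  shows "fibration H (k_prod (k_subspace X A) (k_subspace X C)) (\<lambda>\<gamma>. (\<gamma> 0, \<gamma> 1))"
proof (rule fibrationI)
  have "continuous_map H (k_subspace X C) (\<lambda>\<gamma>. \<gamma> 1)"
    unfolding H_def continuous_map_into_k_subspace[OF k_space_paths_from_into]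
    by (auto intro!: continuous_map_paths_from_into_eval[OF continuous_map_id, unfolded id_def]
        paths_from_into_D(2)[of _ X A C 1])
  then show "continuous_map H (k_prod (k_subspace X A) (k_subspace X C)) (\<lambda>\<gamma>. (\<gamma> 0, \<gamma> 1))"
    using fib unfolding H_def fibration_def
    by (simp add: continuous_map_into_k_prod k_space_paths_from_into)
next
  fix Z :: "((real \<Rightarrow> 'a) \<times> (real \<Rightarrow> 'a \<times> 'a)) topology" and f h
  assume Z: "k_space Z" and f: "continuous_map Z H f"
    and h: "continuous_map (prod_topology unit_interval Z) (k_prod (k_subspace X A) (k_subspace X C)) h"
    and h0: "\<And>z. z \<in> topspace Z \<Longrightarrow> h (0, z) = (f z 0, f z 1)"
  define a where "a = (\<lambda>y. fst (h y))"
  define b where "b = (\<lambda>y. snd (h y))"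
  have a: "continuous_map (prod_topology unit_interval Z) (k_subspace X A) a"
    and b: "continuous_map (prod_topology unit_interval Z) (k_subspace X C) b"
    using continuous_map_k_prod_components[OF h] by (auto simp: a_def b_def)
  have a0: "a (0, z) = f z 0" and b0: "b (0, z) = f z 1" if "z \<in> topspace Z" for z
    using h0[OF that] by (auto simp: a_def b_def)
  have bX: "continuous_map (prod_topology unit_interval Z) X b"
    and bC: "\<And>s z. \<lbrakk>0 \<le> s; s \<le> 1; z \<in> topspace Z\<rbrakk> \<Longrightarrow> b (s, z) \<in> C"
    using b by (auto simp: continuous_map_into_k_subspace k_space_cylinder Z)
  obtain g where g: "continuous_map (prod_topology unit_interval Z) H g"
    and g0: "\<And>z. z \<in> topspace Z \<Longrightarrow> g (0, z) = f z"
    and ga: "\<And>s z. \<lbrakk>s \<in> {0..1}; z \<in> topspace Z\<rbrakk> \<Longrightarrow> g (s, z) 0 = a (s, z)"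
    using fibration_lift[OF fib Z f a] a0 by auto
  have gH: "g (s, z) \<in> topspace (paths_from_into X A C)"
    if "0 \<le> s" "s \<le> 1" "z \<in> topspace Z" for s z
    using continuous_map_funspace[OF g] that by (force simp: H_def)
  \<comment> \<open>The corrected path is parametrised by \<open>u\<close> in \<open>[0, 1 + 2 * s]\<close>, rescaled from \<open>t\<close>: the path
    \<open>g (s, z)\<close> up to 1, the way back up to \<open>1 + s\<close>, then \<open>b\<close>. Clamping the arguments by \<open>c\<close>
    makes each of the three pieces continuous on the whole domain.\<close>
  define u :: "real \<times> real \<times> (real \<Rightarrow> 'a) \<times> (real \<Rightarrow> 'a \<times> 'a) \<Rightarrow> real"
    where "u = (\<lambda>(t, s, z). (1 + 2 * s) * t)"
  define c :: "real \<Rightarrow> real" where "c = (\<lambda>r. max 0 (min 1 r))"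
  define G where "G = (\<lambda>y. if u y \<le> 1 then g (snd y) (c (u y))
    else if u y \<le> 1 + fst (snd y) then g (c (1 + fst (snd y) - u y), snd (snd y)) 1
    else b (c (u y - 1 - fst (snd y)), snd (snd y)))"
  let ?W = "prod_topology unit_interval (prod_topology unit_interval Z)"
  have G: "continuous_map ?W X G"
  proof -
    have I: "continuous_map unit_interval euclideanreal (\<lambda>t. t)"
      by (simp add: continuous_map_from_subtopology)
    have t: "continuous_map ?W euclideanreal fst"
      using continuous_map_compose[OF continuous_map_fst I] by (simp add: o_def)
    have sz: "continuous_map ?W (prod_topology unit_interval Z) snd"
      by (rule continuous_map_snd)
    have s: "continuous_map ?W euclideanreal (\<lambda>y. fst (snd y))"
      using continuous_map_compose[OF continuous_map_compose[OF sz continuous_map_fst] I]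
      by (simp add: o_def)
    have z: "continuous_map ?W Z (\<lambda>y. snd (snd y))"
      using continuous_map_compose[OF sz continuous_map_snd] by (simp add: o_def)
    have u: "continuous_map ?W euclideanreal u"
      unfolding u_def case_prod_unfold
      by (intro continuous_map_real_mult continuous_map_add continuous_map_real_mult_left s t)
         simp
    have s1: "continuous_map ?W euclideanreal (\<lambda>y. 1 + fst (snd y))"
      by (intro continuous_map_add s) simp
    have c: "continuous_map ?W unit_interval (\<lambda>y. c (v y))"
      if "continuous_map ?W euclideanreal v" for v
      unfolding c_def by (rule continuous_map_clamp[OF that])
    have clamped: "continuous_map ?W (prod_topology unit_interval Z) (\<lambda>y. (c (v y), snd (snd y)))"
      if "continuous_map ?W euclideanreal v" for v
      by (rule continuous_map_pairedI[OF c[OF that] z])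
    have head: "continuous_map ?W X (\<lambda>y. g (snd y) (c (u y)))"
      by (rule continuous_map_paths_from_into_eval[OF
            continuous_map_compose[OF sz g, unfolded H_def o_def] c[OF u]])
    have retrace: "continuous_map ?W X (\<lambda>y. g (c (1 + fst (snd y) - u y), snd (snd y)) 1)"
      by (rule continuous_map_paths_from_into_eval[OF
            continuous_map_compose[OF clamped[OF continuous_map_diff[OF s1 u]] g, unfolded H_def o_def]])
         simp
    have "continuous_map ?W euclideanreal (\<lambda>y. u y - 1 - fst (snd y))"
      by (intro continuous_map_diff u s) simp
    from continuous_map_compose[OF clamped[OF this] bX]
    have follow: "continuous_map ?W X (\<lambda>y. b (c (u y - 1 - fst (snd y)), snd (snd y)))"
      by (simp add: o_def)
    have tail: "continuous_map ?W X (\<lambda>y. if u y \<le> 1 + fst (snd y)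
        then g (c (1 + fst (snd y) - u y), snd (snd y)) 1
        else b (c (u y - 1 - fst (snd y)), snd (snd y)))"
      using u s1 continuous_map_from_subtopology[OF retrace] continuous_map_from_subtopology[OF follow]
      by (rule continuous_map_cases_le) (auto simp: c_def g0 b0)
    have one: "continuous_map ?W euclideanreal (\<lambda>y. 1)"
      by simp
    show ?thesis
      unfolding G_def
      using u one continuous_map_from_subtopology[OF head] continuous_map_from_subtopology[OF tail]
      by (rule continuous_map_cases_le) (auto simp: c_def)
  qed
  define k where "k = (\<lambda>y. \<lambda>t\<in>{0..1}. G (t, y))"
  have start: "G (0, s, z) = a (s, z)" if "0 \<le> s" "s \<le> 1" "z \<in> topspace Z" for s z
    using ga that by (simp add: G_def u_def c_def)
  have stop: "G (1, s, z) = b (s, z)" if "0 \<le> s" "s \<le> 1" "z \<in> topspace Z" for s z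
    using that b0 g0 by (cases "s = 0") (auto simp: G_def u_def c_def)
  have inC: "G (t, s, z) \<in> C" if "0 < t" "t \<le> 1" "0 \<le> s" "s \<le> 1" "z \<in> topspace Z" for t s z
  proof -
    have "0 < u (t, s, z)" using that by (simp add: u_def)
    then show ?thesis
      using that by (auto simp: G_def c_def intro!: bC paths_from_into_D(2)[OF gH])
  qed
  have k: "continuous_map (prod_topology unit_interval Z) H k"
    unfolding H_def k_def
  proof (rule continuous_map_into_paths_from_into[OF k_space_cylinder[OF Z] G])
    fix y assume "y \<in> topspace (prod_topology unit_interval Z)"
    then obtain s z where y: "y = (s, z)" "0 \<le> s" "s \<le> 1" "z \<in> topspace Z" by auto
    then show "G (0, y) \<in> A"
      using start paths_from_into_D(1)[OF gH] ga by (metis atLeastAtMost_iff)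
    show "G (t, y) \<in> C" if "0 < t" "t \<le> 1" for t
      using inC that y by blast
  qed
  \<comment> \<open>At \<open>s = 0\<close> the tail has length 0 and \<open>u = t\<close>.\<close>
  have "k (0, z) = f z" if z: "z \<in> topspace Z" for z
  proof
    fix t
    have "f z \<in> extensional {0..1}"
      using paths_from_into_D(3)[OF gH[of 0 z]] z by (simp add: g0)
    then show "k (0, z) t = f z t"
      using z by (auto simp: k_def G_def u_def c_def g0 extensional_def)
  qed
  moreover have "(k (s, z) 0, k (s, z) 1) = h (s, z)" if "s \<in> {0..1}" "z \<in> topspace Z" for s z
    using that by (simp add: k_def start stop a_def b_def)
  ultimately show "\<exists>g. continuous_map (prod_topology unit_interval Z) H g \<and>
      (\<forall>z\<in>topspace Z. g (0, z) = f z) \<and>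
      (\<forall>t\<in>{0..1}. \<forall>z\<in>topspace Z. (g (t, z) 0, g (t, z) 1) = h (t, z))"
    using k by blast
qed


section \<open>Links of strata\<close>

lemma strata_holink_eq_paths_from_into:
  assumes "filtered_space X F"
  shows "strata_holink X F i j = paths_from_into X (stratum F i) (stratum F j)"
proof (cases "i = j")
  case True
  let ?B = "k_subspace X (stratum F i)"
  have "topspace (path_space ?B) \<subseteq> {\<gamma>. \<gamma> 0 \<in> stratum F i \<and> (\<forall>t\<in>{0<..1}. \<gamma> t \<in> stratum F i)}"
    by (force simp: mapping_set_def continuous_map_def)
  then have "k_subspace (path_space ?B)
      {\<gamma>. \<gamma> 0 \<in> stratum F i \<and> (\<forall>t\<in>{0<..1}. \<gamma> t \<in> stratum F i)} = path_space ?B"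
    by (intro k_subspace_topspace) (auto simp: path_space_def)
  with True show ?thesis
    by (simp add: strata_holink_def paths_from_into_def)
next
  case False
  have "stratum F i \<inter> stratum F j = {}" "stratum F j \<subseteq> topspace X"
    using assms False unfolding filtered_space_def disjoint_family_on_def by blast+
  then have "topspace (k_subspace X (stratum F i \<union> stratum F j)) - stratum F i = stratum F j"
    by auto
  with False show ?thesis
    by (simp add: strata_holink_def holink_def paths_from_into_def)
qed

theorem lemma3p5:
  fixes X :: "'a topology" and F :: "'p::order \<Rightarrow> 'a set"
    and x :: "'p \<Rightarrow> 'a" and i j :: 'p
  assumes "homotopically_stratified X F"
    and "\<forall>k. x k \<in> stratum F k"
    and "i \<le> j"
  defines "H \<equiv> strata_holink X F i j"
    and "Xi \<equiv> k_subspace X (stratum F i)"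
    and "Xj \<equiv> k_subspace X (stratum F j)"
  shows "fibration H Xi (\<lambda>\<gamma>. \<gamma> 0) \<and>
         fibration H Xj (\<lambda>\<gamma>. \<gamma> 1) \<and>
         fibration (k_subspace H {\<gamma> \<in> topspace H. \<gamma> 1 = x j}) Xi (\<lambda>\<gamma>. \<gamma> 0) \<and>
         fibration (k_subspace H {\<gamma> \<in> topspace H. \<gamma> 0 = x i}) Xj (\<lambda>\<gamma>. \<gamma> 1) \<and>
         fibration H (k_prod Xi Xj) (\<lambda>\<gamma>. (\<gamma> 0, \<gamma> 1))"
proof -
  have "filtered_space X F" and fib: "fibration H Xi (\<lambda>\<gamma>. \<gamma> 0)"
    using assms(1,3) unfolding homotopically_stratified_def H_def Xi_def by blast+
  then have H: "H = paths_from_into X (stratum F i) (stratum F j)"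
    unfolding H_def by (intro strata_holink_eq_paths_from_into)
  have k: "k_space H"
    unfolding H by (rule k_space_paths_from_into)
  have both: "fibration H (k_prod Xi Xj) (\<lambda>\<gamma>. (\<gamma> 0, \<gamma> 1))"
    using fibration_endpoints fib unfolding H Xi_def Xj_def by blast
  have swapped: "fibration H (k_prod Xj Xi) (\<lambda>\<gamma>. (\<gamma> 1, \<gamma> 0))"
    by (rule fibration_swap[OF both k])
  show ?thesis
    using fib both fibration_component[OF swapped k]
      fibration_component_on_fibre[OF both k] fibration_component_on_fibre[OF swapped k]
    by blast
qed

end
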